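(* For every positive integer $n$ there is a one-one correspondence (bijection) between the set $\mathcal{PC}_n$ of all decreasing and order-preserving partial transformations of an $n$-element chain and the set of all type I lattice paths in an $n\times n$ square.
   Context: Let $X_n=\{1,2,\ldots,n\}$ with its natural order (any $n$-element chain may be used). A partial transformation of $X_n$ is a map $\alpha:\mathrm{Dom}\,\alpha\to X_n$ with $\mathrm{Dom}\,\alpha\subseteq X_n$ (the empty map is allowed); $x\alpha$ denotes the image of $x$. It is decreasing if $x\alpha\le x$ for all $x\in\mathrm{Dom}\,\alpha$, and order-preserving if $x\le y$ implies $x\alpha\le y\alpha$ for all $x,y\in\mathrm{Dom}\,\alpha$. $\mathcal{PC}_n$ is the set (semigroup under composition) of all decreasing and order-preserving partial transformations of $X_n$. A type I lattice path in an $n\times n$ square is a lattice path in the Cartesian plane that starts at $(0,0)$, ends at $(n,n)$, contains no points above the line $y=x$, and is composed only of steps $(1,0)$ (horizontal), $(0,1)$ (vertical) and $(1,1)$ (diagonal). *)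

theory Defs
  imports Main
begin

definition partial_transformations :: "'a set \<Rightarrow> ('a \<rightharpoonup> 'a) set" where
  "partial_transformations X = {\<alpha>. dom \<alpha> \<subseteq> X \<and> ran \<alpha> \<subseteq> X}"

definition decreasing :: "('a::linorder \<rightharpoonup> 'a) \<Rightarrow> bool" where
  "decreasing \<alpha> \<longleftrightarrow> (\<forall>x\<in>dom \<alpha>. the (\<alpha> x) \<le> x)"

definition order_preserving :: "('a::linorder \<rightharpoonup> 'a) \<Rightarrow> bool" where
  "order_preserving \<alpha> \<longleftrightarrow>
     (\<forall>x\<in>dom \<alpha>. \<forall>y\<in>dom \<alpha>. x \<le> y \<longrightarrow> the (\<alpha> x) \<le> the (\<alpha> y))"

definition PC :: "nat \<Rightarrow> (nat \<rightharpoonup> nat) set" where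
  "PC n = {\<alpha> \<in> partial_transformations {1..n}. decreasing \<alpha> \<and> order_preserving \<alpha>}"

definition lattice_step :: "int \<times> int \<Rightarrow> int \<times> int \<Rightarrow> bool" where
  "lattice_step p q \<longleftrightarrow>
     (fst q - fst p, snd q - snd p) \<in> {(1, 0), (0, 1), (1, 1)}"

(* A lattice path is the list of the lattice points it visits, in order.  Requiring y \<le> x at
   these points keeps the whole polygonal path off the region above y = x, since the
   half-plane y \<le> x is convex. *)
definition type_I_paths :: "nat \<Rightarrow> (int \<times> int) list set" where
  "type_I_paths n =
     {ps. ps \<noteq> [] \<and> hd ps = (0, 0) \<and> last ps = (int n, int n) \<and>
          successively lattice_step ps \<and> (\<forall>(x, y)\<in>set ps. y \<le> x)}"

end

theory Submission
  imports Defs "HOL-Library.Equipollence"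
begin

text \<open>
  The correspondence reads a map \<open>\<alpha>\<close> row by row. For \<open>y = 1, \<dots>, n\<close> the path makes one horizontal
  step at height \<open>y - 1\<close> for each point of the fibre \<open>\<alpha>\<^sup>-\<^sup>1(y)\<close>, and then climbs to height \<open>y\<close> by a
  vertical step if \<open>y \<in> dom \<alpha>\<close> and by a diagonal step otherwise. A horizontal step announces a value,
  a vertical step announces a point of the domain, and since \<open>\<alpha>\<close> preserves the order, the \<open>j\<close>-th
  value announced belongs to the \<open>j\<close>-th point announced; so \<open>\<alpha>\<close> can be read off the path. The
  excess \<open>x - y\<close> at a point of the path is the number of horizontal minus the number of vertical
  steps made so far, that is, the number of values still waiting for their argument. It stays
  nonnegative exactly when every value is announced before its argument, which says that \<open>\<alpha>\<close> is
  decreasing.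

  The proof decomposes both sides along the first step of the path. What remains of \<open>\<alpha>\<close> at the
  lattice point \<open>(y + p, y)\<close> is a map on \<open>{y + 1..n}\<close> whose first \<open>p\<close> arguments have already
  received their values; these values no longer matter and are replaced by \<open>0\<close>. Such maps form the
  set \<open>pending_maps n y p\<close>, and \<open>paths_from n (y + p, y)\<close> is the set of the remaining paths. The
  three possible first steps split either set in the same way
  (\<open>paths_from_step\<close> and \<open>pending_maps_split\<close> with the lemmas that follow it), and induction makes
  the two sets equipollent.
\<close>

section \<open>Lattice paths and their first step\<close>

definition paths_from :: "nat \<Rightarrow> int \<times> int \<Rightarrow> (int \<times> int) list set" where
  "paths_from n q =
     {ps. ps \<noteq> [] \<and> hd ps = q \<and> last ps = (int n, int n) \<and>
          successively lattice_step ps \<and> (\<forall>(x, y)\<in>set ps. y \<le> x)}"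

lemma type_I_paths_eq: "type_I_paths n = paths_from n (0, 0)"
  by (simp add: type_I_paths_def paths_from_def)

lemma paths_from_above_diagonal: "x < y \<Longrightarrow> paths_from n (x, y) = {}"
  unfolding paths_from_def using hd_in_set by fastforce

lemma successively_step_fst_mono:
  "ps \<noteq> [] \<Longrightarrow> successively lattice_step ps \<Longrightarrow> fst (hd ps) \<le> fst (last ps)"
proof (induction ps rule: induct_list012)
  case (3 p q ps)
  then have "fst q \<le> fst (last (q # ps))" and "lattice_step p q"
    by auto
  then show ?case by (auto simp: lattice_step_def)
qed auto

lemma paths_from_beyond: "int n < x \<Longrightarrow> paths_from n (x, y) = {}"
  unfolding paths_from_def using successively_step_fst_mono by fastforce

lemma paths_from_cons:
  assumes "y \<le> x"
  shows "(x, y) # ps \<in> paths_from n (x, y) \<longleftrightarrow>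
    (if ps = [] then (x, y) = (int n, int n)
     else ps \<in> paths_from n (x + 1, y) \<union> paths_from n (x, y + 1) \<union> paths_from n (x + 1, y + 1))"
proof (cases ps)
  case (Cons q qs)
  have "lattice_step (x, y) q \<longleftrightarrow> q = (x + 1, y) \<or> q = (x, y + 1) \<or> q = (x + 1, y + 1)"
    by (cases q) (auto simp: lattice_step_def)
  then show ?thesis
    using assms Cons by (auto simp: paths_from_def)
qed (use assms in \<open>auto simp: paths_from_def\<close>)

lemma paths_from_step:
  assumes "y \<le> x" "(x, y) \<noteq> (int n, int n)"
  shows "paths_from n (x, y) = (#) (x, y) `
    (paths_from n (x + 1, y) \<union> paths_from n (x, y + 1) \<union> paths_from n (x + 1, y + 1))"
    (is "_ = _ ` ?R")
proof (intro set_eqI iffI)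
  fix qs assume qs: "qs \<in> paths_from n (x, y)"
  then obtain ps where "qs = (x, y) # ps"
    by (cases qs) (auto simp: paths_from_def)
  with qs paths_from_cons[OF assms(1), of ps n] assms(2) show "qs \<in> (#) (x, y) ` ?R"
    by (auto split: if_splits)
next
  fix qs assume "qs \<in> (#) (x, y) ` ?R"
  then obtain ps where "qs = (x, y) # ps" "ps \<in> ?R" by blast
  moreover from this have "ps \<noteq> []" by (auto simp: paths_from_def)
  ultimately show "qs \<in> paths_from n (x, y)"
    using paths_from_cons[OF assms(1), of ps n] by simp
qed

lemma paths_from_end: "paths_from n (int n, int n) = {[(int n, int n)]}"
proof (intro set_eqI iffI)
  fix qs assume qs: "qs \<in> paths_from n (int n, int n)"
  then obtain ps where "qs = (int n, int n) # ps"
    by (cases qs) (auto simp: paths_from_def)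
  with qs paths_from_cons[of "int n" "int n" ps n] show "qs \<in> {[(int n, int n)]}"
    by (auto simp: paths_from_beyond paths_from_above_diagonal split: if_splits)
qed (auto simp: paths_from_def)

section \<open>Maps with pending values\<close>

lemma decreasing_iff: "decreasing \<alpha> \<longleftrightarrow> (\<forall>x a. \<alpha> x = Some a \<longrightarrow> a \<le> x)"
  by (force simp: decreasing_def)

lemma order_preserving_iff:
  "order_preserving \<alpha> \<longleftrightarrow>
    (\<forall>x y a b. \<alpha> x = Some a \<longrightarrow> \<alpha> y = Some b \<longrightarrow> x \<le> y \<longrightarrow> a \<le> b)"
  by (force simp: order_preserving_def)

text \<open>
  The value \<open>0\<close>, which is below the chain, marks an argument whose true value is at most \<open>y\<close>; order
  preservation puts these arguments first.
\<close>

definition pending_maps :: "nat \<Rightarrow> nat \<Rightarrow> nat \<Rightarrow> (nat \<rightharpoonup> nat) set" where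
  "pending_maps n y p =
     {\<alpha>. dom \<alpha> \<subseteq> {y<..n} \<and> ran \<alpha> \<subseteq> insert 0 {y<..n} \<and> decreasing \<alpha> \<and> order_preserving \<alpha> \<and>
          card {x. \<alpha> x = Some 0} = p}"

lemma pending_maps_iff:
  "\<alpha> \<in> pending_maps n y p \<longleftrightarrow>
     (\<forall>x a. \<alpha> x = Some a \<longrightarrow> y < x \<and> x \<le> n \<and> (a = 0 \<or> y < a) \<and> a \<le> x) \<and>
     (\<forall>x x' a a'. \<alpha> x = Some a \<longrightarrow> \<alpha> x' = Some a' \<longrightarrow> x \<le> x' \<longrightarrow> a \<le> a') \<and>
     card {x. \<alpha> x = Some 0} = p"
  unfolding pending_maps_def decreasing_iff order_preserving_iff
  by (fastforce simp: ran_def dom_def subset_iff)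

lemma pending_mapsD:
  assumes "\<alpha> \<in> pending_maps n y p"
  shows "\<alpha> x = Some a \<Longrightarrow> y < x" "\<alpha> x = Some a \<Longrightarrow> x \<le> n" "\<alpha> x = Some a \<Longrightarrow> a = 0 \<or> y < a"
    "\<alpha> x = Some a \<Longrightarrow> a \<le> x"
    "\<alpha> x = Some a \<Longrightarrow> \<alpha> x' = Some a' \<Longrightarrow> x \<le> x' \<Longrightarrow> a \<le> a'"
    "card {x. \<alpha> x = Some 0} = p"
  using assms unfolding pending_maps_iff by blast+

lemma pending_maps_finite_fibre:
  assumes "\<alpha> \<in> pending_maps n y p"
  shows "finite {x. \<alpha> x = Some a}"
  by (rule finite_subset[of _ "{..n}"]) (auto dest: pending_mapsD(2)[OF assms])

lemma PC_eq: "PC n = pending_maps n 0 0"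
proof (intro set_eqI iffI)
  fix \<alpha> assume "\<alpha> \<in> PC n"
  then have "dom \<alpha> \<subseteq> {1..n}" "ran \<alpha> \<subseteq> {1..n}" "decreasing \<alpha>" "order_preserving \<alpha>"
    by (auto simp: PC_def partial_transformations_def)
  moreover from \<open>ran \<alpha> \<subseteq> {1..n}\<close> have "{x. \<alpha> x = Some 0} = {}"
    by (force simp: ran_def)
  ultimately show "\<alpha> \<in> pending_maps n 0 0"
    unfolding pending_maps_def by (auto simp: atLeastSucAtMost_greaterThanAtMost)
next
  fix \<alpha> assume \<alpha>: "\<alpha> \<in> pending_maps n 0 0"
  then have "{x. \<alpha> x = Some 0} = {}"
    using pending_mapsD(6)[OF \<alpha>] pending_maps_finite_fibre[OF \<alpha>, of 0] by simp
  then have "0 \<notin> ran \<alpha>" by (auto simp: ran_def)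
  with \<alpha> show "\<alpha> \<in> PC n"
    by (fastforce simp: pending_maps_def PC_def partial_transformations_def subset_iff)
qed

text \<open>
  Only the \<open>n - y\<close> points above \<open>y\<close> can be pending; on the other side, no path to \<open>(n, n)\<close> passes to
  the right of \<open>x = n\<close>.
\<close>

lemma pending_maps_too_many:
  assumes "y \<le> n" "n < y + p"
  shows "pending_maps n y p = {}"
proof -
  have "p \<le> n - y" if "\<alpha> \<in> pending_maps n y p" for \<alpha>
  proof -
    have "{x. \<alpha> x = Some 0} \<subseteq> {y<..n}"
      using pending_mapsD(1,2)[OF that] by auto
    from card_mono[OF _ this] show ?thesis
      by (simp add: pending_mapsD(6)[OF that])
  qed
  with assms show ?thesis by fastforce
qed

lemma pending_maps_end: "pending_maps n n 0 = {Map.empty}"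
proof -
  have "\<alpha> = Map.empty" if "\<alpha> \<in> pending_maps n n 0" for \<alpha>
    using that by (auto simp: pending_maps_def)
  moreover have "Map.empty \<in> pending_maps n n 0"
    by (auto simp: pending_maps_iff)
  ultimately show ?thesis by blast
qed

text \<open>
  The next step of the path is horizontal if some argument still has the value \<open>y + 1\<close>. Otherwise
  row \<open>y + 1\<close> is complete, and the path climbs: vertically if \<open>y + 1\<close> is an argument, and diagonally
  if it is not.
\<close>

definition next_value_used :: "nat \<Rightarrow> nat \<Rightarrow> nat \<Rightarrow> (nat \<rightharpoonup> nat) set" where
  "next_value_used n y p = {\<alpha> \<in> pending_maps n y p. Suc y \<in> ran \<alpha>}"

definition next_argument_pending :: "nat \<Rightarrow> nat \<Rightarrow> nat \<Rightarrow> (nat \<rightharpoonup> nat) set" where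
  "next_argument_pending n y p = {\<alpha> \<in> pending_maps n y p. Suc y \<notin> ran \<alpha> \<and> Suc y \<in> dom \<alpha>}"

definition next_argument_absent :: "nat \<Rightarrow> nat \<Rightarrow> nat \<Rightarrow> (nat \<rightharpoonup> nat) set" where
  "next_argument_absent n y p = {\<alpha> \<in> pending_maps n y p. Suc y \<notin> ran \<alpha> \<and> Suc y \<notin> dom \<alpha>}"

lemma pending_maps_split:
  "pending_maps n y p =
     next_value_used n y p \<union> next_argument_pending n y p \<union> next_argument_absent n y p"
  by (auto simp: next_value_used_def next_argument_pending_def next_argument_absent_def)

text \<open>
  Announcing one value \<open>y + 1\<close> makes the least argument of that value pending. By order
  preservation all arguments below it are pending already, so it becomes the greatest pending
  argument, and giving that one the value \<open>y + 1\<close> is the inverse operation.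
\<close>

lemma next_value_used_eqpoll: "next_value_used n y p \<approx> pending_maps n y (Suc p)"
proof -
  define demote where "demote \<alpha> = \<alpha>(Min {x. \<alpha> x = Some (Suc y)} \<mapsto> 0)" for \<alpha> :: "nat \<rightharpoonup> nat"
  define promote where "promote \<beta> = \<beta>(Max {x. \<beta> x = Some 0} \<mapsto> Suc y)" for \<beta> :: "nat \<rightharpoonup> nat"
  have demote: "demote \<alpha> \<in> pending_maps n y (Suc p) \<and> promote (demote \<alpha>) = \<alpha>"
    if "\<alpha> \<in> next_value_used n y p" for \<alpha>
  proof -
    have \<alpha>: "\<alpha> \<in> pending_maps n y p" and "{x. \<alpha> x = Some (Suc y)} \<noteq> {}"
      using that by (auto simp: next_value_used_def ran_def)
    note D = pending_mapsD[OF \<alpha>] and fin = pending_maps_finite_fibre[OF \<alpha>]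
    define l where "l = Min {x. \<alpha> x = Some (Suc y)}"
    have l: "\<alpha> l = Some (Suc y)"
      using Min_in[OF fin \<open>_ \<noteq> {}\<close>] by (simp add: l_def)
    have least: "l \<le> x" if "\<alpha> x = Some (Suc y)" for x
      using that fin by (simp add: l_def)
    have before: "a = 0" if "\<alpha> x = Some a" "x < l" for x a
      using D(3)[OF that(1)] D(5)[OF that(1) l] least[of x] that by force
    have zero: "x < l" if "\<alpha> x = Some 0" for x
      using D(5)[OF l that] by linarith
    have \<beta>: "demote \<alpha> = \<alpha>(l \<mapsto> 0)" by (simp add: demote_def l_def)
    have Z: "{x. demote \<alpha> x = Some 0} = insert l {x. \<alpha> x = Some 0}"
      by (auto simp: \<beta>)
    have "card {x. demote \<alpha> x = Some 0} = Suc p"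
      unfolding Z using fin[of 0] D(6) l by simp
    moreover have "y < x \<and> x \<le> n \<and> (a = 0 \<or> y < a) \<and> a \<le> x" if "demote \<alpha> x = Some a" for x a
      using that D(1-4)[of x a] D(1,2)[OF l] by (auto simp: \<beta> split: if_splits)
    moreover have "a \<le> a'"
      if "demote \<alpha> x = Some a" "demote \<alpha> x' = Some a'" "x \<le> x'" for x x' a a'
      using that before[of x a] D(5)[of x a x' a'] by (auto simp: \<beta> split: if_splits)
    ultimately have "demote \<alpha> \<in> pending_maps n y (Suc p)"
      unfolding pending_maps_iff by blast
    moreover have "Max {x. demote \<alpha> x = Some 0} = l"
      unfolding Z using fin[of 0] zero by (intro Max_eqI) (auto intro: less_imp_le)
    then have "promote (demote \<alpha>) = \<alpha>"
      unfolding promote_def using l by (auto simp: \<beta>)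
    ultimately show ?thesis ..
  qed
  have promote: "promote \<beta> \<in> next_value_used n y p \<and> demote (promote \<beta>) = \<beta>"
    if \<beta>: "\<beta> \<in> pending_maps n y (Suc p)" for \<beta>
  proof -
    note D = pending_mapsD[OF \<beta>] and fin = pending_maps_finite_fibre[OF \<beta>]
    have "{x. \<beta> x = Some 0} \<noteq> {}" using D(6) by force
    define g where "g = Max {x. \<beta> x = Some 0}"
    have g: "\<beta> g = Some 0"
      using Max_in[OF fin \<open>_ \<noteq> {}\<close>] by (simp add: g_def)
    have greatest: "x \<le> g" if "\<beta> x = Some 0" for x
      using that fin by (simp add: g_def)
    have before: "a = 0" if "\<beta> x = Some a" "x \<le> g" for x a
      using D(5)[OF that(1) g that(2)] by simp
    have after: "Suc y \<le> a" if "\<beta> x = Some a" "g < x" for x a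
      using D(3)[OF that(1)] greatest[of x] that by force
    have \<alpha>: "promote \<beta> = \<beta>(g \<mapsto> Suc y)" by (simp add: promote_def g_def)
    have Z: "{x. promote \<beta> x = Some 0} = {x. \<beta> x = Some 0} - {g}"
      by (auto simp: \<alpha>)
    have "card {x. promote \<beta> x = Some 0} = p"
      unfolding Z using fin[of 0] D(6) g by simp
    moreover have "y < x \<and> x \<le> n \<and> (a = 0 \<or> y < a) \<and> a \<le> x" if "promote \<beta> x = Some a" for x a
      using that D(1-4)[of x a] D(1,2)[OF g] by (auto simp: \<alpha> split: if_splits)
    moreover have "a \<le> a'"
      if "promote \<beta> x = Some a" "promote \<beta> x' = Some a'" "x \<le> x'" for x x' a a'
      using that before[of x a] after[of x' a'] D(5)[of x a x' a']
      by (auto simp: \<alpha> split: if_splits)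
    ultimately have mem: "promote \<beta> \<in> pending_maps n y p"
      unfolding pending_maps_iff by blast
    have "promote \<beta> g = Some (Suc y)" by (simp add: \<alpha>)
    with mem have "promote \<beta> \<in> next_value_used n y p"
      by (auto simp: next_value_used_def intro: ranI)
    moreover have "Min {x. promote \<beta> x = Some (Suc y)} = g"
    proof (rule Min_eqI)
      show "finite {x. promote \<beta> x = Some (Suc y)}"
        by (rule pending_maps_finite_fibre[OF mem])
      show "g \<le> x" if "x \<in> {x. promote \<beta> x = Some (Suc y)}" for x
        using that before[of x "Suc y"] by (cases "x \<le> g") (auto simp: \<alpha> split: if_splits)
    qed (simp add: \<alpha>)
    then have "demote (promote \<beta>) = \<beta>"
      unfolding demote_def using g by (auto simp: \<alpha>)
    ultimately show ?thesis ..
  qed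
  have "bij_betw demote (next_value_used n y p) (pending_maps n y (Suc p))"
    by (rule bij_betw_byWitness[where f' = promote]) (use demote promote in auto)
  then show ?thesis by (auto simp: eqpoll_def)
qed

text \<open>
  When the argument \<open>y + 1\<close> is reached while the value \<open>y + 1\<close> is absent, a decreasing map can only
  have left it pending; so some value waits for it, and taking it out of the domain settles it.
\<close>

lemma next_argument_pending_value:
  assumes "\<alpha> \<in> next_argument_pending n y p"
  shows "\<alpha> (Suc y) = Some 0"
proof -
  have \<alpha>: "\<alpha> \<in> pending_maps n y p" using assms by (simp add: next_argument_pending_def)
  obtain a where a: "\<alpha> (Suc y) = Some a" "a \<noteq> Suc y"
    using assms by (auto simp: next_argument_pending_def ran_def)
  with pending_mapsD(3,4)[OF \<alpha> a(1)] show ?thesis by auto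
qed

lemma next_argument_pending_0: "next_argument_pending n y 0 = {}"
proof -
  have False if "\<alpha> \<in> next_argument_pending n y 0" for \<alpha>
  proof -
    have \<alpha>: "\<alpha> \<in> pending_maps n y 0" using that by (simp add: next_argument_pending_def)
    have "{x. \<alpha> x = Some 0} = {}"
      using pending_mapsD(6)[OF \<alpha>] pending_maps_finite_fibre[OF \<alpha>, of 0] by simp
    then show False using next_argument_pending_value[OF that] by blast
  qed
  then show ?thesis by blast
qed

lemma next_argument_pending_eqpoll:
  assumes "y < n"
  shows "next_argument_pending n y (Suc p) \<approx> pending_maps n (Suc y) p"
proof -
  let ?remove = "\<lambda>\<alpha> :: nat \<rightharpoonup> nat. \<alpha>(Suc y := None)"
  let ?insert = "\<lambda>\<beta> :: nat \<rightharpoonup> nat. \<beta>(Suc y \<mapsto> 0)"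
  have remove: "?remove \<alpha> \<in> pending_maps n (Suc y) p \<and> ?insert (?remove \<alpha>) = \<alpha>"
    if "\<alpha> \<in> next_argument_pending n y (Suc p)" for \<alpha>
  proof -
    have \<alpha>: "\<alpha> \<in> pending_maps n y (Suc p)" and absent: "\<And>x. \<alpha> x \<noteq> Some (Suc y)"
      using that by (auto simp: next_argument_pending_def ran_def)
    note D = pending_mapsD[OF \<alpha>]
    have v: "\<alpha> (Suc y) = Some 0" by (rule next_argument_pending_value[OF that])
    have "{x. ?remove \<alpha> x = Some 0} = {x. \<alpha> x = Some 0} - {Suc y}" by auto
    then have "card {x. ?remove \<alpha> x = Some 0} = p"
      using v D(6) pending_maps_finite_fibre[OF \<alpha>, of 0] by simp
    moreover have "Suc y < x \<and> x \<le> n \<and> (a = 0 \<or> Suc y < a) \<and> a \<le> x"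
      if "?remove \<alpha> x = Some a" for x a
    proof -
      from that have "\<alpha> x = Some a" "x \<noteq> Suc y" by (auto split: if_splits)
      with D(1-4)[OF this(1)] absent[of x] show ?thesis by auto
    qed
    ultimately have "?remove \<alpha> \<in> pending_maps n (Suc y) p"
      unfolding pending_maps_iff using D(5) by (auto split: if_splits)
    with v show ?thesis by auto
  qed
  have insert: "?insert \<beta> \<in> next_argument_pending n y (Suc p) \<and> ?remove (?insert \<beta>) = \<beta>"
    if \<beta>: "\<beta> \<in> pending_maps n (Suc y) p" for \<beta>
  proof -
    note D = pending_mapsD[OF \<beta>]
    have fresh: "\<beta> (Suc y) = None"
      using D(1)[of "Suc y"] by (cases "\<beta> (Suc y)") auto
    have "{x. ?insert \<beta> x = Some 0} = insert (Suc y) {x. \<beta> x = Some 0}" by auto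
    then have "card {x. ?insert \<beta> x = Some 0} = Suc p"
      using fresh D(6) pending_maps_finite_fibre[OF \<beta>, of 0] by simp
    moreover have "y < x \<and> x \<le> n \<and> (a = 0 \<or> y < a) \<and> a \<le> x"
      if "?insert \<beta> x = Some a" for x a
      using that assms D(1-4)[of x a] by (auto split: if_splits)
    moreover have "a \<le> a'" if "?insert \<beta> x = Some a" "?insert \<beta> x' = Some a'" "x \<le> x'" for x x' a a'
      using that D(1)[of x a] D(5)[of x a x' a'] by (auto split: if_splits)
    ultimately have "?insert \<beta> \<in> pending_maps n y (Suc p)"
      unfolding pending_maps_iff by blast
    moreover have "Suc y \<notin> ran (?insert \<beta>)"
      using D(3)[of _ "Suc y"] by (auto simp: ran_def split: if_splits)
    ultimately show ?thesis
      using fresh by (auto simp: next_argument_pending_def)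
  qed
  have "bij_betw ?remove (next_argument_pending n y (Suc p)) (pending_maps n (Suc y) p)"
    by (rule bij_betw_byWitness[where f' = ?insert]) (use remove insert in auto)
  then show ?thesis by (auto simp: eqpoll_def)
qed

lemma next_argument_absent_eq: "next_argument_absent n y p = pending_maps n (Suc y) p"
proof (intro set_eqI iffI)
  fix \<alpha> assume "\<alpha> \<in> next_argument_absent n y p"
  then have \<alpha>: "\<alpha> \<in> pending_maps n y p" and "Suc y \<notin> ran \<alpha>" "Suc y \<notin> dom \<alpha>"
    by (auto simp: next_argument_absent_def)
  then have "\<alpha> x \<noteq> Some (Suc y)" "\<alpha> (Suc y) \<noteq> Some a" for x a
    by (auto simp: ran_def)
  then show "\<alpha> \<in> pending_maps n (Suc y) p"
    using \<alpha> unfolding pending_maps_iff by (metis Suc_lessI)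
next
  fix \<alpha> assume \<alpha>: "\<alpha> \<in> pending_maps n (Suc y) p"
  then have "\<alpha> \<in> pending_maps n y p"
    unfolding pending_maps_iff by (meson Suc_lessD)
  moreover have "Suc y \<notin> ran \<alpha>" "Suc y \<notin> dom \<alpha>"
    using pending_mapsD(1,3)[OF \<alpha>] by (fastforce simp: ran_def)+
  ultimately show "\<alpha> \<in> next_argument_absent n y p"
    by (simp add: next_argument_absent_def)
qed

section \<open>The correspondence\<close>

lemma pending_maps_eqpoll_paths_from:
  assumes "y \<le> n"
  shows "pending_maps n y p \<approx> paths_from n (int (y + p), int y)"
  using assms
  \<comment> \<open>The two summands are the distances to the upper and to the right edge of the square: a
    horizontal step inside the square lowers the second one, a vertical or diagonal step the first.\<close>
proof (induction "(n - y) + (n - (y + p))" arbitrary: y p rule: less_induct)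
  case less
  let ?x = "int (y + p)" and ?y = "int y"
  consider (beyond) "n < y + p" | (final) "y = n" "p = 0" | (inner) "y < n" "y + p \<le> n"
    using less.prems by linarith
  then show ?case
  proof cases
    case beyond
    with less.prems show ?thesis by (simp add: pending_maps_too_many paths_from_beyond)
  next
    case final
    then show ?thesis by (simp add: pending_maps_end paths_from_end singleton_eqpoll)
  next
    case inner
    have horizontal: "next_value_used n y p \<approx> paths_from n (?x + 1, ?y)"
    proof (cases "y + p = n")
      case True
      then show ?thesis
        using next_value_used_eqpoll[of n y p]
        by (simp add: pending_maps_too_many paths_from_beyond)
    next
      case False
      with inner less.hyps[of y "Suc p"] have "pending_maps n y (Suc p) \<approx> paths_from n (?x + 1, ?y)"
        by (simp add: add_ac)
      with next_value_used_eqpoll show ?thesis by (rule eqpoll_trans)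
    qed
    have vertical: "next_argument_pending n y p \<approx> paths_from n (?x, ?y + 1)"
    proof (cases p)
      case 0
      then show ?thesis by (simp add: next_argument_pending_0 paths_from_above_diagonal)
    next
      case (Suc q)
      with inner less.hyps[of "Suc y" q] have "pending_maps n (Suc y) q \<approx> paths_from n (?x, ?y + 1)"
        by (simp add: add_ac)
      with next_argument_pending_eqpoll[OF \<open>y < n\<close>] show ?thesis
        unfolding Suc by (rule eqpoll_trans)
    qed
    have diagonal: "next_argument_absent n y p \<approx> paths_from n (?x + 1, ?y + 1)"
      using inner less.hyps[of "Suc y" p] by (simp add: next_argument_absent_eq add_ac)
    have "pending_maps n y p \<approx>
        paths_from n (?x + 1, ?y) \<union> paths_from n (?x, ?y + 1) \<union> paths_from n (?x + 1, ?y + 1)"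
      unfolding pending_maps_split
      by (intro Un_eqpoll_cong horizontal vertical diagonal)
        (auto simp: disjnt_Un1 next_value_used_def next_argument_pending_def
          next_argument_absent_def disjnt_def paths_from_def)
    also have "\<dots> \<approx> paths_from n (?x, ?y)"
      using inner by (subst paths_from_step)
        (auto intro!: eqpoll_sym[OF inj_on_image_eqpoll_self])
    finally show ?thesis .
  qed
qed

theorem theorem3p1:
  fixes n :: nat
  assumes "n \<ge> 1"
  shows "\<exists>f. bij_betw f (PC n) (type_I_paths n)"
  using pending_maps_eqpoll_paths_from[of 0 n 0]
  by (simp add: PC_eq type_I_paths_eq eqpoll_def)

end
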